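(* There exists a three-state discounted MDP and a training distribution $\mu$ concentrated at the initial state for which a policy $\pi\in\Pi$ is first-order stationary ($R_{\mathrm{pol}}(\pi)=0$) but strictly globally suboptimal ($J_\mu(\pi)<\max_{\pi'\in\Pi}J_\mu(\pi')$). In the construction, the current policy $\pi$ never visits a downstream state. Changing only the upstream action or only the downstream action is non-improving, while changing both raises the return from $1$ to $9$. Hence occupancy coverage is a first-order identifiability condition.
   Context: For a finite discounted MDP with transition kernel $P$, reward $r$ and discount $0<\gamma<1$, and $\pi\in\Pi=\prod_s\Delta(\mathcal A)$: $P_\pi(s,s')=\sum_a\pi(a|s)P(s'|s,a)$, $r_\pi(s)=\sum_a\pi(a|s)r(s,a)$, $M_\pi=I-\gamma P_\pi$, $V^\pi=M_\pi^{-1}r_\pi$, the return is $J_\mu(\pi)=\mu^{\mathsf T}V^\pi$, $F_\mu=-J_\mu$, $d_\mu^\pi=(1-\gamma)M_\pi^{-\mathsf T}\mu$ is the normalized discounted state occupancy, and $R_{\mathrm{pol}}(\pi)=\operatorname{dist}(0,\nabla F_\mu(\pi)+N_\Pi(\pi))$ is the policy-stationarity residual, where $N_\Pi$ is the normal cone of $\Pi$ and the gradient is with respect to the coordinates $\pi(a|s)$. The upstream action is the one at the initial state, the downstream action the one at the unvisited downstream state. Occupancy coverage, for an evaluation distribution $\nu$ with optimal policy $\pi^\star$, is the condition $\operatorname{supp}d_\nu^{\pi^\star}\subseteq\operatorname{supp}d_\mu^\pi$; under it the performance gap $J_\nu(\pi^\star)-J_\nu(\pi)$ is bounded by a finite multiple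 of $R_{\mathrm{pol}}(\pi)$, and the proposition shows that this condition cannot be removed. *)

theory Defs
  imports "HOL-Analysis.Analysis"
begin

record ('s, 'a) mdp =
  trans :: "'s \<Rightarrow> 'a \<Rightarrow> 's \<Rightarrow> real"  \<comment> \<open>\<open>trans m s a s'\<close> is \<open>P(s' | s, a)\<close>\<close>
  reward :: "'s \<Rightarrow> 'a \<Rightarrow> real"
  discount :: real

definition discounted_mdp :: "('s::finite, 'a::finite) mdp \<Rightarrow> bool" where
  "discounted_mdp m \<longleftrightarrow>
     0 < discount m \<and> discount m < 1 \<and>
     (\<forall>s a s'. 0 \<le> trans m s a s') \<and> (\<forall>s a. (\<Sum>s'\<in>UNIV. trans m s a s') = 1)"

definition prob_simplex :: "(real ^ 'n::finite) set" where
  "prob_simplex = {p. (\<forall>i. 0 \<le> p $ i) \<and> (\<Sum>i\<in>UNIV. p $ i) = 1}"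

text \<open>
  A policy is the array of its coordinates, \<open>\<pi> $ s $ a\<close> being \<open>\<pi>(a | s)\<close>. All quantities below are
  defined by the same formulas on the whole Euclidean space containing the policy polytope, so that
  gradients with respect to these coordinates make sense.
\<close>

definition policies :: "(real ^ 'a::finite ^ 's::finite) set" where
  "policies = {\<pi>. \<forall>s. \<pi> $ s \<in> prob_simplex}"

definition det_policy :: "('s::finite \<Rightarrow> 'a::finite) \<Rightarrow> real ^ 'a ^ 's" where
  "det_policy f = (\<chi> s. axis (f s) 1)"

definition P_pol :: "('s::finite, 'a::finite) mdp \<Rightarrow> real ^ 'a ^ 's \<Rightarrow> real ^ 's ^ 's" where
  "P_pol m \<pi> = (\<chi> s s'. \<Sum>a\<in>UNIV. \<pi> $ s $ a * trans m s a s')"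

definition r_pol :: "('s::finite, 'a::finite) mdp \<Rightarrow> real ^ 'a ^ 's \<Rightarrow> real ^ 's" where
  "r_pol m \<pi> = (\<chi> s. \<Sum>a\<in>UNIV. \<pi> $ s $ a * reward m s a)"

definition M_pol :: "('s::finite, 'a::finite) mdp \<Rightarrow> real ^ 'a ^ 's \<Rightarrow> real ^ 's ^ 's" where
  "M_pol m \<pi> = mat 1 - discount m *\<^sub>R P_pol m \<pi>"

definition V_pol :: "('s::finite, 'a::finite) mdp \<Rightarrow> real ^ 'a ^ 's \<Rightarrow> real ^ 's" where
  "V_pol m \<pi> = matrix_inv (M_pol m \<pi>) *v r_pol m \<pi>"

definition J :: "('s::finite, 'a::finite) mdp \<Rightarrow> real ^ 's \<Rightarrow> real ^ 'a ^ 's \<Rightarrow> real" where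
  "J m \<mu> \<pi> = \<mu> \<bullet> V_pol m \<pi>"

definition F :: "('s::finite, 'a::finite) mdp \<Rightarrow> real ^ 's \<Rightarrow> real ^ 'a ^ 's \<Rightarrow> real" where
  "F m \<mu> \<pi> = - J m \<mu> \<pi>"

definition occupancy :: "('s::finite, 'a::finite) mdp \<Rightarrow> real ^ 's \<Rightarrow> real ^ 'a ^ 's \<Rightarrow> real ^ 's" where
  "occupancy m \<mu> \<pi> = (1 - discount m) *\<^sub>R (transpose (matrix_inv (M_pol m \<pi>)) *v \<mu>)"

definition supp :: "real ^ 's::finite \<Rightarrow> 's set" where
  "supp d = {s. d $ s \<noteq> 0}"

definition optimal_policy ::
    "('s::finite, 'a::finite) mdp \<Rightarrow> real ^ 's \<Rightarrow> real ^ 'a ^ 's \<Rightarrow> bool" where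
  "optimal_policy m \<mu> \<pi> \<longleftrightarrow> \<pi> \<in> policies \<and> (\<forall>\<pi>'\<in>policies. J m \<mu> \<pi>' \<le> J m \<mu> \<pi>)"

definition occupancy_coverage ::
    "('s::finite, 'a::finite) mdp \<Rightarrow> real ^ 's \<Rightarrow> real ^ 's \<Rightarrow> real ^ 'a ^ 's \<Rightarrow> real ^ 'a ^ 's \<Rightarrow> bool" where
  "occupancy_coverage m \<mu> \<nu> \<pi> \<pi>star \<longleftrightarrow>
     supp (occupancy m \<nu> \<pi>star) \<subseteq> supp (occupancy m \<mu> \<pi>)"

text \<open>Unique where it exists, because \<open>GDERIV\<close> uses the full neighbourhood filter.\<close>

definition gradient :: "('v::real_inner \<Rightarrow> real) \<Rightarrow> 'v \<Rightarrow> 'v" where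
  "gradient f x = (THE g. GDERIV f x :> g)"

definition normal_cone :: "'v::real_inner set \<Rightarrow> 'v \<Rightarrow> 'v set" where
  "normal_cone C x = (if x \<in> C then {v. \<forall>y\<in>C. v \<bullet> (y - x) \<le> 0} else {})"

text \<open>
  The set below is empty, and the value of \<open>infdist\<close> then a meaningless \<open>0\<close>, when \<open>\<pi>\<close> is not a
  policy; the residual is used for policies only, where the normal cone contains \<open>0\<close>.
\<close>

definition R_pol :: "('s::finite, 'a::finite) mdp \<Rightarrow> real ^ 's \<Rightarrow> real ^ 'a ^ 's \<Rightarrow> real" where
  "R_pol m \<mu> \<pi> = infdist 0 ((\<lambda>v. gradient (F m \<mu>) \<pi> + v) ` normal_cone policies \<pi>)"

end

theory Submission
  imports Defs
begin

text \<open>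
  A policy is stationary iff \<open>d\<^sub>\<mu>\<^sup>\<pi> \<bullet> A(\<pi>' - \<pi>) \<le> 0\<close> for every policy \<open>\<pi>'\<close>, where \<open>A\<close> is the
  (linear) advantage. Varying \<open>\<pi>'\<close> at a single state shows that the advantage of every policy is
  nonpositive at every state visited from \<open>\<mu>\<close>. Under coverage the performance difference
  \<open>d\<^sub>\<nu>\<^sup>\<pi>\<^sup>* \<bullet> A(\<pi>\<^sup>* - \<pi>)\<close> only sees such states, so a zero residual forces a zero gap; and a positive
  residual bounds the gap trivially. At an unvisited state the advantage is unconstrained: the
  example hides a reward of 18 there, worth 9 at the initial state for discount 1/2.
\<close>

section \<open>Matrix inverses and convex combinations\<close>

lemma invertible_matrix_inv:
  fixes A :: "'a::semiring_1 ^ 'n ^ 'm"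
  assumes "invertible A"
  shows "A ** matrix_inv A = mat 1" "matrix_inv A ** A = mat 1"
proof -
  have "\<exists>A'. A ** A' = mat 1 \<and> A' ** A = mat 1"
    using assms by (simp add: invertible_def)
  from someI_ex[OF this] show "A ** matrix_inv A = mat 1" "matrix_inv A ** A = mat 1"
    by (simp_all add: matrix_inv_def)
qed

lemma invertible_matrix_inv_vector:
  fixes A :: "real ^ 'n ^ 'n"
  assumes "invertible A"
  shows "A *v (matrix_inv A *v x) = x" "matrix_inv A *v (A *v x) = x"
  by (simp_all add: matrix_vector_mul_assoc invertible_matrix_inv[OF assms])

lemma invertible_if_trivial_kernel:
  fixes A :: "real ^ 'n ^ 'n"
  assumes "\<And>w. A *v w = 0 \<Longrightarrow> w = 0"
  shows "invertible A"
proof -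
  have "inj ((*v) A)"
  proof (rule injI)
    fix x y assume "A *v x = A *v y"
    then show "x = y"
      using assms[of "x - y"] by (simp add: matrix_vector_mult_diff_distrib)
  qed
  then show ?thesis
    by (simp add: invertible_left_inverse matrix_left_invertible_injective)
qed

lemma convex_combination_ge:
  fixes p x :: "'i::finite \<Rightarrow> real"
  assumes "\<And>i. 0 \<le> p i" "(\<Sum>i\<in>UNIV. p i) = 1" "\<And>i. k \<le> x i"
  shows "k \<le> (\<Sum>i\<in>UNIV. p i * x i)"
proof -
  have "k = (\<Sum>i\<in>UNIV. p i * k)"
    by (simp add: sum_distrib_right[symmetric] assms(2))
  also have "\<dots> \<le> (\<Sum>i\<in>UNIV. p i * x i)"
    by (intro sum_mono mult_left_mono assms)
  finally show ?thesis .
qed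

section \<open>The policy polytope and the transition operator\<close>

lemma policiesD:
  assumes "\<pi> \<in> policies"
  shows "0 \<le> \<pi> $ s $ a" "(\<Sum>a\<in>UNIV. \<pi> $ s $ a) = 1"
  using assms by (auto simp: policies_def prob_simplex_def)

lemma policies_coordinate_update:
  assumes "\<pi> \<in> policies" "\<pi>' \<in> policies"
  shows "(\<chi> t. if t = s then \<pi>' $ t else \<pi> $ t) \<in> policies"
  using assms by (simp add: policies_def)

lemma axis_in_prob_simplex: "axis i 1 \<in> prob_simplex"
  by (auto simp: prob_simplex_def axis_def)

lemma det_policy_nth: "det_policy f $ s $ a = (if a = f s then 1 else 0)"
  by (simp add: det_policy_def axis_def)

lemma det_policy_in_policies: "det_policy f \<in> policies"
  by (simp add: policies_def det_policy_def axis_in_prob_simplex)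

lemma P_pol_mult_nth:
  "(P_pol m \<pi> *v w) $ s = (\<Sum>a\<in>UNIV. \<pi> $ s $ a * (\<Sum>s'\<in>UNIV. trans m s a s' * w $ s'))"
  unfolding P_pol_def matrix_vector_mult_def
  by (simp add: sum_distrib_left sum_distrib_right mult.assoc) (rule sum.swap)

lemma M_pol_mult: "M_pol m \<pi> *v w = w - discount m *\<^sub>R (P_pol m \<pi> *v w)"
  by (simp add: M_pol_def matrix_vector_mult_diff_rdistrib scaleR_matrix_vector_assoc)

lemma P_pol_add: "P_pol m (\<pi> + \<pi>') = P_pol m \<pi> + P_pol m \<pi>'"
  by (simp add: P_pol_def vec_eq_iff distrib_right sum.distrib)

lemma P_pol_diff: "P_pol m (\<pi> - \<pi>') = P_pol m \<pi> - P_pol m \<pi>'"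
  by (simp add: P_pol_def vec_eq_iff left_diff_distrib sum_subtractf)

lemma P_pol_scaleR: "P_pol m (c *\<^sub>R \<pi>) = c *\<^sub>R P_pol m \<pi>"
  by (simp add: P_pol_def vec_eq_iff sum_distrib_left mult.assoc)

text \<open>Finite dimension turns bilinearity into a bound that is uniform in the direction and the
  vector, as the perturbation estimate for \<open>M_pol\<close> needs.\<close>

lemma bounded_bilinear_P_pol: "bounded_bilinear (\<lambda>\<pi> w. P_pol m \<pi> *v w)"
  unfolding bilinear_conv_bounded_bilinear[symmetric] bilinear_def
  by (auto intro!: linearI simp: P_pol_add P_pol_scaleR algebra_simps scaleR_matrix_vector_assoc)

section \<open>Minimum principle, invertibility and occupancies\<close>

text \<open>Discrete minimum principle. At a state where \<open>w\<close> attains its minimum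
  \<open>k\<close>, the average \<open>P_pol m \<pi> *v w\<close> is at least \<open>k\<close>, so
  \<gamma> k \<le> k, and \<gamma> < 1 forces 0 \<le> k. It yields both the invertibility of
  \<open>M_pol\<close> and the nonnegativity of its inverse.\<close>

lemma M_pol_mult_nonneg_imp_nonneg:
  fixes m :: "('s::finite, 'a::finite) mdp"
  assumes m: "discounted_mdp m" and \<pi>: "\<pi> \<in> policies"
    and nonneg: "\<And>s. 0 \<le> (M_pol m \<pi> *v w) $ s"
  shows "0 \<le> w $ s"
proof -
  define k where "k = Min (range (($) w))"
  have k_le: "k \<le> w $ t" for t
    by (simp add: k_def)
  have "k \<in> range (($) w)"
    unfolding k_def by (rule Min_in) auto
  then obtain t where t: "k = w $ t"
    by auto
  have future: "k \<le> (\<Sum>s'\<in>UNIV. trans m t a s' * w $ s')" for a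
    by (rule convex_combination_ge) (use m k_le in \<open>auto simp: discounted_mdp_def\<close>)
  have "k \<le> (P_pol m \<pi> *v w) $ t"
    unfolding P_pol_mult_nth by (rule convex_combination_ge[OF policiesD[OF \<pi>] future])
  moreover have \<gamma>: "0 < discount m" "discount m < 1"
    using m by (auto simp: discounted_mdp_def)
  ultimately have "discount m * k \<le> discount m * (P_pol m \<pi> *v w) $ t"
    by (intro mult_left_mono) auto
  also have "\<dots> \<le> k"
    using nonneg[of t] by (simp add: M_pol_mult t)
  finally have "0 \<le> (1 - discount m) * k"
    by (simp add: algebra_simps)
  then have "0 \<le> k"
    using \<gamma> by (simp add: zero_le_mult_iff)
  then show ?thesis
    using k_le[of s] by linarith
qed

text \<open>The minimum principle applied to \<open>w\<close> and to \<open>- w\<close> makes the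
  kernel trivial.\<close>

lemma invertible_M_pol:
  fixes m :: "('s::finite, 'a::finite) mdp"
  assumes "discounted_mdp m" "\<pi> \<in> policies"
  shows "invertible (M_pol m \<pi>)"
proof (rule invertible_if_trivial_kernel)
  fix w assume w: "M_pol m \<pi> *v w = 0"
  then have "M_pol m \<pi> *v (- w) = 0"
    using matrix_vector_mult_diff_distrib[of "M_pol m \<pi>" 0 w] by simp
  with w have "0 \<le> w $ s" "0 \<le> (- w) $ s" for s
    using M_pol_mult_nonneg_imp_nonneg[OF assms, of w] M_pol_mult_nonneg_imp_nonneg[OF assms, of "- w"]
    by simp_all
  then show "w = 0"
    by (simp add: vec_eq_iff order_antisym)
qed

lemma V_pol_eqI:
  assumes "invertible (M_pol m \<pi>)" "M_pol m \<pi> *v v = r_pol m \<pi>"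
  shows "V_pol m \<pi> = v"
  using invertible_matrix_inv_vector(2)[OF assms(1), of v] by (simp add: V_pol_def assms(2))

lemma occupancy_inner:
  "occupancy m \<mu> \<pi> \<bullet> x = (1 - discount m) * (\<mu> \<bullet> (matrix_inv (M_pol m \<pi>) *v x))"
  by (simp add: occupancy_def dot_lmul_matrix)

text \<open>The hypothesis on \<eta> is the flow balance equation; checking it identifies an
  occupancy without computing an inverse.\<close>

lemma occupancy_eqI:
  assumes "invertible (M_pol m \<pi>)" "\<eta> v* M_pol m \<pi> = (1 - discount m) *\<^sub>R \<mu>"
  shows "occupancy m \<mu> \<pi> = \<eta>"
proof -
  have "occupancy m \<mu> \<pi> \<bullet> x = \<eta> \<bullet> x" for x
  proof -
    have "occupancy m \<mu> \<pi> \<bullet> x = (\<eta> v* M_pol m \<pi>) \<bullet> (matrix_inv (M_pol m \<pi>) *v x)"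
      by (simp add: occupancy_inner assms(2))
    then show ?thesis
      by (simp add: dot_lmul_matrix invertible_matrix_inv_vector(1)[OF assms(1)])
  qed
  then show ?thesis
    by (metis vector_eq_rdot)
qed

text \<open>Up to the factor 1 - \<gamma>, the coordinate is \<mu> paired with column
  \<open>s\<close> of the inverse, and that column is nonnegative by the minimum principle.\<close>

lemma occupancy_nonneg:
  fixes m :: "('s::finite, 'a::finite) mdp"
  assumes m: "discounted_mdp m" and \<pi>: "\<pi> \<in> policies" and \<mu>: "\<And>s. 0 \<le> \<mu> $ s"
  shows "0 \<le> occupancy m \<mu> \<pi> $ s"
proof -
  have "0 \<le> (matrix_inv (M_pol m \<pi>) *v axis s 1) $ t" for t
    by (rule M_pol_mult_nonneg_imp_nonneg[OF m \<pi>])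
      (simp add: invertible_matrix_inv_vector(1)[OF invertible_M_pol[OF m \<pi>]] axis_def)
  then have "0 \<le> \<mu> \<bullet> (matrix_inv (M_pol m \<pi>) *v axis s 1)"
    unfolding inner_vec_def using \<mu> by (auto intro!: sum_nonneg)
  moreover have "discount m < 1"
    using m by (simp add: discounted_mdp_def)
  moreover have "occupancy m \<mu> \<pi> $ s = occupancy m \<mu> \<pi> \<bullet> axis s 1"
    by (simp add: inner_axis)
  ultimately show ?thesis
    by (simp add: occupancy_inner)
qed

section \<open>Advantages and the performance difference\<close>

text \<open>The state-action value function, stored in the space of policy coordinates so that its
  blocks can serve as blocks of a gradient.\<close>

definition Q_pol :: "('s::finite, 'a::finite) mdp \<Rightarrow> real ^ 'a ^ 's \<Rightarrow> real ^ 'a ^ 's" where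
  "Q_pol m \<pi> = (\<chi> s a. reward m s a + discount m * (\<Sum>s'\<in>UNIV. trans m s a s' * V_pol m \<pi> $ s'))"

text \<open>The argument is a direction \<open>h\<close>, which makes the map linear; for
  \<open>h = \<pi>' - \<pi>\<close> it is the expected advantage of \<open>\<pi>'\<close> over \<pi>
  when \<open>M_pol m \<pi>\<close> is invertible.\<close>

definition advantage ::
    "('s::finite, 'a::finite) mdp \<Rightarrow> real ^ 'a ^ 's \<Rightarrow> real ^ 'a ^ 's \<Rightarrow> real ^ 's" where
  "advantage m \<pi> h = (\<chi> s. h $ s \<bullet> Q_pol m \<pi> $ s)"

lemma linear_advantage: "linear (advantage m \<pi>)"
  by (rule linearI) (simp_all add: advantage_def vec_eq_iff inner_add_left)

lemma advantage_eq: "advantage m \<pi> h = r_pol m h + discount m *\<^sub>R (P_pol m h *v V_pol m \<pi>)"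
  by (simp add: advantage_def Q_pol_def vec_eq_iff P_pol_mult_nth r_pol_def inner_vec_def
      distrib_left sum.distrib sum_distrib_left mult.left_commute)

text \<open>Difference of the two Bellman equations. Assuming invertibility instead of membership in
  \<open>policies\<close> lets the identity be used in a full neighbourhood of \<pi>, where
  derivatives are taken.\<close>

lemma M_pol_mult_V_pol_diff:
  assumes \<pi>: "invertible (M_pol m \<pi>)" and \<pi>': "invertible (M_pol m \<pi>')"
  shows "M_pol m \<pi>' *v (V_pol m \<pi>' - V_pol m \<pi>) = advantage m \<pi> (\<pi>' - \<pi>)"
proof -
  have V: "M_pol m \<pi> *v V_pol m \<pi> = r_pol m \<pi>" "M_pol m \<pi>' *v V_pol m \<pi>' = r_pol m \<pi>'"
    using \<pi> \<pi>' by (simp_all add: V_pol_def invertible_matrix_inv_vector(1))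
  have r: "r_pol m (\<pi>' - \<pi>) = r_pol m \<pi>' - r_pol m \<pi>"
    by (simp add: r_pol_def vec_eq_iff left_diff_distrib sum_subtractf)
  show ?thesis
    unfolding advantage_eq matrix_vector_mult_diff_distrib V(2) r V(1)[symmetric]
    by (simp add: M_pol_mult P_pol_diff algebra_simps)
qed

lemma performance_difference:
  assumes \<pi>: "invertible (M_pol m \<pi>)" and \<pi>': "invertible (M_pol m \<pi>')"
  shows "(1 - discount m) * (J m \<mu> \<pi>' - J m \<mu> \<pi>)
    = occupancy m \<mu> \<pi>' \<bullet> advantage m \<pi> (\<pi>' - \<pi>)"
proof -
  have "matrix_inv (M_pol m \<pi>') *v advantage m \<pi> (\<pi>' - \<pi>) = V_pol m \<pi>' - V_pol m \<pi>"
    by (simp add: M_pol_mult_V_pol_diff[OF \<pi> \<pi>', symmetric] invertible_matrix_inv_vector(2)[OF \<pi>'])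
  then show ?thesis
    by (simp add: occupancy_inner J_def inner_diff_right)
qed

section \<open>Differentiability of the value function\<close>

text \<open>
  The differentiability of \<open>J\<close> at \<open>\<pi>\<close> comes from \<open>M\<^bsub>\<pi>+h\<^esub> = M\<^bsub>\<pi>\<^esub> - \<gamma> P\<^bsub>h\<^esub>\<close>: solutions of
  \<open>M\<^bsub>\<pi>+h\<^esub> w = b\<close> satisfy \<open>w = M\<^bsub>\<pi>\<^esub>\<^sup>-\<^sup>1 (b + \<gamma> P\<^bsub>h\<^esub> w)\<close>, which for small \<open>h\<close> bounds \<open>w\<close> by \<open>b\<close>.
\<close>

lemma M_pol_perturbation:
  fixes m :: "('s::finite, 'a::finite) mdp"
  assumes inv: "invertible (M_pol m \<pi>)"
  obtains K L where "0 < K" "0 < L"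
    "\<And>\<pi>' w. norm (\<pi>' - \<pi>) \<le> L \<Longrightarrow> norm w \<le> K * norm (M_pol m \<pi>' *v w)"
    "\<And>\<pi>' w. norm (w - matrix_inv (M_pol m \<pi>) *v (M_pol m \<pi>' *v w)) \<le> K * norm (\<pi>' - \<pi>) * norm w"
proof -
  let ?N = "(*v) (matrix_inv (M_pol m \<pi>))"
  obtain a where a: "a > 0" "\<And>x. norm (?N x) \<le> norm x * a"
    using bounded_linear.pos_bounded[of ?N] by auto
  obtain b where b: "b > 0" "\<And>h w. norm (P_pol m h *v w) \<le> norm h * norm w * b"
    using bounded_bilinear.pos_bounded[OF bounded_bilinear_P_pol[of m]] by blast
  define c where "c = a * (\<bar>discount m\<bar> * b)"
  \<comment> \<open>\<open>K\<close> dominates both the factor \<open>2 * a\<close> of the first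
    bound and the factor \<open>c\<close> of the second. \<open>L\<close> is chosen so that
    \<open>c * L \<le> 1 / 2\<close>; its denominator uses \<open>c + 1\<close> because
    \<open>c\<close> may vanish.\<close>
  define K where "K = 2 * a + c + 1"
  define L where "L = 1 / (2 * (c + 1))"
  have c: "0 \<le> c"
    using a b by (simp add: c_def)
  have expand: "w - ?N (M_pol m \<pi>' *v w) = ?N (discount m *\<^sub>R (P_pol m (\<pi>' - \<pi>) *v w))" for \<pi>' w
  proof -
    have "M_pol m \<pi> *v w = M_pol m \<pi>' *v w + discount m *\<^sub>R (P_pol m (\<pi>' - \<pi>) *v w)"
      by (simp add: M_pol_mult P_pol_diff algebra_simps)
    then have "?N (M_pol m \<pi> *v w)
        = ?N (M_pol m \<pi>' *v w) + ?N (discount m *\<^sub>R (P_pol m (\<pi>' - \<pi>) *v w))"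
      by (simp only: matrix_vector_right_distrib)
    then show ?thesis
      by (simp only: invertible_matrix_inv_vector(2)[OF inv]) (metis add_diff_cancel_left')
  qed
  have rem: "norm (w - ?N (M_pol m \<pi>' *v w)) \<le> c * norm (\<pi>' - \<pi>) * norm w" for \<pi>' w
  proof -
    have "norm (w - ?N (M_pol m \<pi>' *v w))
        \<le> norm (discount m *\<^sub>R (P_pol m (\<pi>' - \<pi>) *v w)) * a"
      unfolding expand by (rule a(2))
    also have "\<dots> \<le> (\<bar>discount m\<bar> * (norm (\<pi>' - \<pi>) * norm w * b)) * a"
      unfolding norm_scaleR using a(1) by (intro mult_right_mono mult_left_mono b(2)) auto
    finally show ?thesis
      by (simp add: c_def mult_ac)
  qed
  show thesis
  proof
    show "0 < K" "0 < L"
      using a c by (simp_all add: K_def L_def add_pos_nonneg)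
  next
    fix \<pi>' and w :: "real ^ 's"
    assume "norm (\<pi>' - \<pi>) \<le> L"
    then have "c * norm (\<pi>' - \<pi>) \<le> c * L"
      using c by (rule mult_left_mono)
    also have "\<dots> \<le> 1 / 2"
      using c by (simp add: L_def field_simps)
    \<comment> \<open>Half of \<open>norm w\<close> is absorbed into the left-hand side, which
      doubles the constant \<open>a\<close>.\<close>
    finally have "c * norm (\<pi>' - \<pi>) * norm w \<le> 1 / 2 * norm w"
      by (rule mult_right_mono) simp
    moreover have "norm w \<le> norm (w - ?N (M_pol m \<pi>' *v w)) + norm (?N (M_pol m \<pi>' *v w))"
      by (metis add.commute diff_add_cancel norm_triangle_ineq)
    ultimately have "norm w \<le> 2 * a * norm (M_pol m \<pi>' *v w)"
      using rem[of w \<pi>'] a(2)[of "M_pol m \<pi>' *v w"] by (simp add: mult.commute)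
    also have "\<dots> \<le> K * norm (M_pol m \<pi>' *v w)"
      using c by (intro mult_right_mono) (auto simp: K_def)
    finally show "norm w \<le> K * norm (M_pol m \<pi>' *v w)" .
  next
    fix \<pi>' and w :: "real ^ 's"
    have "c * norm (\<pi>' - \<pi>) * norm w \<le> K * norm (\<pi>' - \<pi>) * norm w"
      using a by (intro mult_right_mono) (auto simp: K_def)
    with rem[of w \<pi>']
    show "norm (w - ?N (M_pol m \<pi>' *v w)) \<le> K * norm (\<pi>' - \<pi>) * norm w"
      by linarith
  qed
qed

text \<open>The difference of values solves
  \<open>M_pol m \<pi>' *v w = advantage m \<pi> (\<pi>' - \<pi>)\<close>, hence is of first order
  in \<open>\<pi>' - \<pi>\<close>. Replacing the inverse at \<open>\<pi>'\<close> by the one at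
  \<pi> costs one more factor of that order.\<close>

lemma has_derivative_V_pol:
  fixes m :: "('s::finite, 'a::finite) mdp"
  assumes inv: "invertible (M_pol m \<pi>)"
  shows "(V_pol m has_derivative (\<lambda>h. matrix_inv (M_pol m \<pi>) *v advantage m \<pi> h)) (at \<pi>)"
  unfolding has_derivative_at_alt
proof (intro conjI allI impI)
  show "bounded_linear (\<lambda>h. matrix_inv (M_pol m \<pi>) *v advantage m \<pi> h)"
    using linear_compose[OF linear_advantage[of m \<pi>] matrix_vector_mul_linear]
    by (simp add: o_def linear_conv_bounded_linear)
next
  fix e :: real assume e: "e > 0"
  obtain K L where KL: "0 < K" "0 < L"
    and bound: "\<And>\<pi>' w. norm (\<pi>' - \<pi>) \<le> L \<Longrightarrow> norm w \<le> K * norm (M_pol m \<pi>' *v w)"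
    and rem: "\<And>\<pi>' w. norm (w - matrix_inv (M_pol m \<pi>) *v (M_pol m \<pi>' *v w))
      \<le> K * norm (\<pi>' - \<pi>) * norm w"
    using M_pol_perturbation[OF inv] by blast
  obtain B where B: "B > 0" "\<And>h. norm (advantage m \<pi> h) \<le> norm h * B"
    using bounded_linear.pos_bounded[of "advantage m \<pi>"] linear_advantage[of m \<pi>]
    by (auto simp: linear_conv_bounded_linear)
  \<comment> \<open>The error will be at most \<open>K * K * B\<close> times the squared distance:
    one \<open>K\<close> from \<open>rem\<close>, the other \<open>K\<close> and \<open>B\<close>
    from bounding the difference of values.\<close>
  define d where "d = min L (e / (K * K * B))"
  have "norm (V_pol m \<pi>' - V_pol m \<pi> - matrix_inv (M_pol m \<pi>) *v advantage m \<pi> (\<pi>' - \<pi>))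
      \<le> e * norm (\<pi>' - \<pi>)" if \<pi>': "norm (\<pi>' - \<pi>) < d" for \<pi>'
  proof -
    have L: "norm (\<pi>' - \<pi>) \<le> L" and "norm (\<pi>' - \<pi>) \<le> e / (K * K * B)"
      using \<pi>' by (simp_all add: d_def)
    then have small: "K * K * B * norm (\<pi>' - \<pi>) \<le> e"
      using KL B by (simp add: field_simps)
    \<comment> \<open>\<open>\<pi>'\<close> may lie outside the polytope, so invertibility comes
      from closeness to \<pi>.\<close>
    have "w = 0" if "M_pol m \<pi>' *v w = 0" for w
      using bound[OF L, of w] that by simp
    then have "invertible (M_pol m \<pi>')"
      by (rule invertible_if_trivial_kernel)
    then have eq: "M_pol m \<pi>' *v (V_pol m \<pi>' - V_pol m \<pi>) = advantage m \<pi> (\<pi>' - \<pi>)"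
      by (rule M_pol_mult_V_pol_diff[OF inv])
    have "norm (V_pol m \<pi>' - V_pol m \<pi>) \<le> K * norm (advantage m \<pi> (\<pi>' - \<pi>))"
      using bound[OF L, of "V_pol m \<pi>' - V_pol m \<pi>"] by (simp only: eq)
    also have "\<dots> \<le> K * (norm (\<pi>' - \<pi>) * B)"
      using KL by (intro mult_left_mono B(2)) simp
    finally have V: "norm (V_pol m \<pi>' - V_pol m \<pi>) \<le> K * (norm (\<pi>' - \<pi>) * B)" .
    have "norm (V_pol m \<pi>' - V_pol m \<pi> - matrix_inv (M_pol m \<pi>) *v advantage m \<pi> (\<pi>' - \<pi>))
        \<le> K * norm (\<pi>' - \<pi>) * norm (V_pol m \<pi>' - V_pol m \<pi>)"
      using rem[of "V_pol m \<pi>' - V_pol m \<pi>" \<pi>'] by (simp only: eq)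
    also have "\<dots> \<le> K * norm (\<pi>' - \<pi>) * (K * (norm (\<pi>' - \<pi>) * B))"
      using KL by (intro mult_left_mono V) simp
    also have "\<dots> = K * K * B * norm (\<pi>' - \<pi>) * norm (\<pi>' - \<pi>)"
      by simp
    also have "\<dots> \<le> e * norm (\<pi>' - \<pi>)"
      using small by (rule mult_right_mono) simp
    finally show ?thesis .
  qed
  moreover have "d > 0"
    using KL B e by (simp add: d_def)
  ultimately show "\<exists>d>0. \<forall>\<pi>'. norm (\<pi>' - \<pi>) < d \<longrightarrow>
      norm (V_pol m \<pi>' - V_pol m \<pi> - matrix_inv (M_pol m \<pi>) *v advantage m \<pi> (\<pi>' - \<pi>))
      \<le> e * norm (\<pi>' - \<pi>)"
    by blast
qed

section \<open>Policy gradient, normal cone and stationarity\<close>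

lemma gradient_eqI:
  assumes "GDERIV f x :> g"
  shows "gradient f x = g"
  unfolding gradient_def
proof (rule the_equality[where P = "\<lambda>g. GDERIV f x :> g", OF assms])
  fix g' assume "GDERIV f x :> g'"
  with assms have "(\<lambda>h. h \<bullet> g') = (\<lambda>h. h \<bullet> g)"
    unfolding gderiv_def by (blast intro: has_derivative_unique)
  then show "g' = g"
    by (metis vector_eq_ldot)
qed

text \<open>The policy gradient theorem, multiplied by 1 - \<gamma> to clear the normalization of
  the occupancy.\<close>

lemma gradient_F_inner:
  fixes m :: "('s::finite, 'a::finite) mdp"
  assumes m: "discounted_mdp m" and inv: "invertible (M_pol m \<pi>)"
  shows "(1 - discount m) * (gradient (F m \<mu>) \<pi> \<bullet> h) = - (occupancy m \<mu> \<pi> \<bullet> advantage m \<pi> h)"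
proof -
  define g where "g = (\<chi> s. (- (occupancy m \<mu> \<pi> $ s / (1 - discount m))) *\<^sub>R Q_pol m \<pi> $ s)"
  have \<gamma>: "1 - discount m \<noteq> 0"
    using m by (simp add: discounted_mdp_def)
  have g: "(1 - discount m) * (h \<bullet> g) = - (occupancy m \<mu> \<pi> \<bullet> advantage m \<pi> h)" for h
    using \<gamma> by (simp add: g_def advantage_def inner_vec_def[of h] inner_vec_def[of "occupancy m \<mu> \<pi>"]
        sum_distrib_left sum_negf)
  have "(F m \<mu> has_derivative (\<lambda>h. - (\<mu> \<bullet> (matrix_inv (M_pol m \<pi>) *v advantage m \<pi> h)))) (at \<pi>)"
    unfolding F_def J_def
    by (intro has_derivative_minus has_derivative_inner_right has_derivative_V_pol inv)
  moreover have "- (\<mu> \<bullet> (matrix_inv (M_pol m \<pi>) *v advantage m \<pi> h)) = h \<bullet> g" for h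
  proof -
    have "(1 - discount m) * - (\<mu> \<bullet> (matrix_inv (M_pol m \<pi>) *v advantage m \<pi> h))
        = (1 - discount m) * (h \<bullet> g)"
      by (simp add: g occupancy_inner)
    with \<gamma> show ?thesis
      by (simp only: mult_cancel_left) simp
  qed
  ultimately have "GDERIV (F m \<mu>) \<pi> :> g"
    by (simp add: gderiv_def)
  then show ?thesis
    using g[of h] by (simp add: gradient_eqI inner_commute)
qed

lemma closed_normal_cone: "closed (normal_cone C x)"
proof (cases "x \<in> C")
  case True
  then have "normal_cone C x = (\<Inter>y\<in>C. {v. v \<bullet> (y - x) \<le> 0})"
    by (auto simp: normal_cone_def)
  then show ?thesis
    by (auto intro!: closed_INT closed_Collect_le continuous_intros)
qed (simp add: normal_cone_def)

text \<open>The translated cone is closed and nonempty, so distance zero means that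
  \<open>- g\<close> lies in the cone; this is the variational inequality.\<close>

lemma infdist_zero_normal_cone_iff:
  assumes "x \<in> C"
  shows "infdist 0 ((\<lambda>v. g + v) ` normal_cone C x) = 0 \<longleftrightarrow> (\<forall>y\<in>C. 0 \<le> g \<bullet> (y - x))"
proof -
  have "0 \<in> normal_cone C x"
    using assms by (simp add: normal_cone_def)
  then have "infdist 0 ((\<lambda>v. g + v) ` normal_cone C x) = 0 \<longleftrightarrow> 0 \<in> (\<lambda>v. g + v) ` normal_cone C x"
    by (intro in_closed_iff_infdist_zero[symmetric] closed_translation closed_normal_cone) auto
  also have "\<dots> \<longleftrightarrow> - g \<in> normal_cone C x"
    by (auto simp: image_iff add_eq_0_iff)
  also have "\<dots> \<longleftrightarrow> (\<forall>y\<in>C. 0 \<le> g \<bullet> (y - x))"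
    using assms by (simp add: normal_cone_def)
  finally show ?thesis .
qed

lemma R_pol_eq_0_iff:
  fixes m :: "('s::finite, 'a::finite) mdp"
  assumes m: "discounted_mdp m" and \<pi>: "\<pi> \<in> policies"
  shows "R_pol m \<mu> \<pi> = 0 \<longleftrightarrow>
    (\<forall>\<pi>'\<in>policies. occupancy m \<mu> \<pi> \<bullet> advantage m \<pi> (\<pi>' - \<pi>) \<le> 0)"
proof -
  have "0 \<le> gradient (F m \<mu>) \<pi> \<bullet> h \<longleftrightarrow> occupancy m \<mu> \<pi> \<bullet> advantage m \<pi> h \<le> 0" for h
    using gradient_F_inner[OF m invertible_M_pol[OF m \<pi>], of \<mu> h] m
    by (smt (verit) discounted_mdp_def zero_le_mult_iff)
  then show ?thesis
    by (simp add: R_pol_def infdist_zero_normal_cone_iff[OF \<pi>])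
qed

section \<open>The gap bound under coverage\<close>

lemma stationary_advantage_nonpos:
  fixes m :: "('s::finite, 'a::finite) mdp"
  assumes m: "discounted_mdp m" and \<pi>: "\<pi> \<in> policies" and \<mu>: "\<And>s. 0 \<le> \<mu> $ s"
    and R: "R_pol m \<mu> \<pi> = 0" and \<pi>': "\<pi>' \<in> policies"
    and s: "s \<in> supp (occupancy m \<mu> \<pi>)"
  shows "advantage m \<pi> (\<pi>' - \<pi>) $ s \<le> 0"
proof -
  \<comment> \<open>The polytope is a product over states, so altering \<pi> at \<open>s\<close>
    alone stays inside it and isolates one coordinate of the advantage.\<close>
  define y where "y = (\<chi> t. if t = s then \<pi>' $ t else \<pi> $ t)"
  have "y \<in> policies"
    unfolding y_def by (rule policies_coordinate_update[OF \<pi> \<pi>'])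
  then have "occupancy m \<mu> \<pi> \<bullet> advantage m \<pi> (y - \<pi>) \<le> 0"
    using R R_pol_eq_0_iff[OF m \<pi>] by blast
  moreover have "advantage m \<pi> (y - \<pi>) = axis s (advantage m \<pi> (\<pi>' - \<pi>) $ s)"
    by (simp add: advantage_def y_def vec_eq_iff axis_def)
  moreover have "0 < occupancy m \<mu> \<pi> $ s"
    using occupancy_nonneg[OF m \<pi> \<mu>, of s] s by (simp add: supp_def)
  ultimately show ?thesis
    by (simp add: inner_axis mult_le_0_iff)
qed

text \<open>The performance difference is nonpositive term by term: states visited by
  \<open>\<pi>'\<close> from \<nu> are visited by \<pi> from \<mu>, and all others have weight
  zero.\<close>

lemma covered_stationary_dominates:
  fixes m :: "('s::finite, 'a::finite) mdp"
  assumes m: "discounted_mdp m" and \<mu>: "\<And>s. 0 \<le> \<mu> $ s" and \<nu>: "\<And>s. 0 \<le> \<nu> $ s"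
    and \<pi>: "\<pi> \<in> policies" and \<pi>': "\<pi>' \<in> policies"
    and cov: "occupancy_coverage m \<mu> \<nu> \<pi> \<pi>'" and R: "R_pol m \<mu> \<pi> = 0"
  shows "J m \<nu> \<pi>' \<le> J m \<nu> \<pi>"
proof -
  have "occupancy m \<nu> \<pi>' $ s * advantage m \<pi> (\<pi>' - \<pi>) $ s \<le> 0" for s
  proof (cases "s \<in> supp (occupancy m \<nu> \<pi>')")
    case True
    then have "advantage m \<pi> (\<pi>' - \<pi>) $ s \<le> 0"
      using cov by (intro stationary_advantage_nonpos[OF m \<pi> \<mu> R \<pi>']) (auto simp: occupancy_coverage_def)
    then show ?thesis
      using occupancy_nonneg[OF m \<pi>' \<nu>] by (simp add: mult_nonneg_nonpos)
  qed (simp add: supp_def)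
  then have "occupancy m \<nu> \<pi>' \<bullet> advantage m \<pi> (\<pi>' - \<pi>) \<le> 0"
    by (simp add: inner_vec_def sum_nonpos)
  then have "(1 - discount m) * (J m \<nu> \<pi>' - J m \<nu> \<pi>) \<le> 0"
    by (simp add: performance_difference[OF invertible_M_pol[OF m \<pi>] invertible_M_pol[OF m \<pi>']])
  moreover have "0 < 1 - discount m"
    using m by (simp add: discounted_mdp_def)
  ultimately show ?thesis
    by (simp add: mult_le_0_iff)
qed

text \<open>The constant may depend on \<pi>, so for a nonzero residual the quotient serves; the
  content lies in the case of residual zero.\<close>

lemma covered_gap_bound:
  fixes m :: "('s::finite, 'a::finite) mdp"
  assumes "discounted_mdp m" "\<mu> \<in> prob_simplex" "\<nu> \<in> prob_simplex" "\<pi> \<in> policies"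
    "optimal_policy m \<nu> \<pi>star" "occupancy_coverage m \<mu> \<nu> \<pi> \<pi>star"
  shows "\<exists>C. J m \<nu> \<pi>star - J m \<nu> \<pi> \<le> C * R_pol m \<mu> \<pi>"
proof (cases "R_pol m \<mu> \<pi> = 0")
  case True
  have "J m \<nu> \<pi>star \<le> J m \<nu> \<pi>"
    using assms True
    by (intro covered_stationary_dominates[of m \<mu>]) (auto simp: prob_simplex_def optimal_policy_def)
  then show ?thesis
    by (simp add: True)
next
  case False
  then show ?thesis
    by (intro exI[of _ "(J m \<nu> \<pi>star - J m \<nu> \<pi>) / R_pol m \<mu> \<pi>"]) simp
qed

section \<open>The detour example\<close>

text \<open>State 1 is initial, 2 is downstream and 3 is terminal.\<close>

definition detour_mdp :: "(3, 2) mdp" where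
  "detour_mdp = \<lparr>
     trans = (\<lambda>s a s'. if s' = (if s = 1 \<and> a = 2 then 2 else 3) then 1 else 0),
     reward = (\<lambda>s a. if s = 1 \<and> a = 1 then 1 else if s = 2 \<and> a = 2 then 18 else 0),
     discount = 1 / 2\<rparr>"

lemma discounted_detour_mdp: "discounted_mdp detour_mdp"
  by (auto simp: discounted_mdp_def detour_mdp_def)

text \<open>The closed form is checked against the Bellman equation; the 9 is the hidden reward 18
  discounted once.\<close>

lemma V_pol_detour_mdp:
  assumes "\<pi> \<in> policies"
  shows "V_pol detour_mdp \<pi>
    = (\<chi> s. if s = 1 then \<pi> $ 1 $ 1 + 9 * (\<pi> $ 1 $ 2 * \<pi> $ 2 $ 2) else if s = 2 then 18 * \<pi> $ 2 $ 2 else 0)"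
  by (rule V_pol_eqI[OF invertible_M_pol[OF discounted_detour_mdp assms]])
    (simp add: M_pol_mult vec_eq_iff forall_3 P_pol_mult_nth r_pol_def sum_2 sum_3 detour_mdp_def)

lemma J_detour_mdp:
  assumes "\<pi> \<in> policies"
  shows "J detour_mdp (axis 1 1) \<pi> = \<pi> $ 1 $ 1 + 9 * (\<pi> $ 1 $ 2 * \<pi> $ 2 $ 2)"
  by (simp add: J_def V_pol_detour_mdp[OF assms] inner_axis')

lemma J_detour_mdp_le:
  assumes "\<pi> \<in> policies"
  shows "J detour_mdp (axis 1 1) \<pi> \<le> 9"
proof -
  have p: "0 \<le> \<pi> $ 1 $ 1" "0 \<le> \<pi> $ 1 $ 2" "\<pi> $ 1 $ 1 + \<pi> $ 1 $ 2 = 1" "\<pi> $ 2 $ 2 \<le> 1"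
    using policiesD(1)[OF assms, of 1] policiesD(1)[OF assms, of 2 1] policiesD(2)[OF assms, of 1]
      policiesD(2)[OF assms, of 2]
    by (simp_all add: sum_2)
  then have "\<pi> $ 1 $ 2 * \<pi> $ 2 $ 2 \<le> \<pi> $ 1 $ 2"
    by (simp add: mult_left_le)
  with p show ?thesis
    by (simp add: J_detour_mdp[OF assms])
qed

text \<open>The current policy moves straight from 1 to 3 and stays there, so with discount 1/2 each
  carries half of the mass.\<close>

lemma occupancy_detour_mdp:
  "occupancy detour_mdp (axis 1 1) (det_policy (\<lambda>_. 1)) = (\<chi> s. if s = 2 then 0 else 1 / 2)"
  by (rule occupancy_eqI[OF invertible_M_pol[OF discounted_detour_mdp det_policy_in_policies]])
    (simp add: vec_eq_iff forall_3 vector_matrix_mult_def sum_2 sum_3 M_pol_def P_pol_def mat_def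
      detour_mdp_def det_policy_def axis_def)

lemma R_pol_detour_mdp: "R_pol detour_mdp (axis 1 1) (det_policy (\<lambda>_. 1)) = 0"
  unfolding R_pol_eq_0_iff[OF discounted_detour_mdp det_policy_in_policies]
proof
  fix \<pi>' :: "real ^ 2 ^ 3" assume \<pi>': "\<pi>' \<in> policies"
  let ?\<pi> = "det_policy (\<lambda>_. 1) :: real ^ 2 ^ 3"
  \<comment> \<open>State 2 has weight zero and state 3 pays nothing. At state 1 the detour is worth
    0, since the current policy collects nothing downstream, so only the loss of the immediate
    reward 1 remains.\<close>
  have "occupancy detour_mdp (axis 1 1) ?\<pi> \<bullet> advantage detour_mdp ?\<pi> (\<pi>' - ?\<pi>) = (\<pi>' $ 1 $ 1 - 1) / 2"
    unfolding occupancy_detour_mdp advantage_def Q_pol_def V_pol_detour_mdp[OF det_policy_in_policies]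
    by (simp add: inner_vec_def sum_2 sum_3 detour_mdp_def det_policy_nth)
  also have "\<dots> \<le> 0"
    using policiesD(1)[OF \<pi>', of 1 2] policiesD(2)[OF \<pi>', of 1] by (simp add: sum_2)
  finally show "occupancy detour_mdp (axis 1 1) ?\<pi> \<bullet> advantage detour_mdp ?\<pi> (\<pi>' - ?\<pi>) \<le> 0" .
qed

text \<open>The identifiability claim is rendered as a contrast: the example violates the linear gap
  bound for every optimal policy, and the second conjunct shows that coverage restores it in
  general.\<close>

theorem proposition6p5:
  "(\<exists>(m :: (3, 2) mdp) (\<mu> :: real ^ 3) (init :: 3) (down :: 3) (f :: 3 \<Rightarrow> 2) (up' :: 2) (down' :: 2) \<pi>.
      discounted_mdp m \<and> init \<noteq> down \<and> \<mu> = axis init 1 \<and>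
      \<pi> = det_policy f \<and> \<pi> \<in> policies \<and>
      R_pol m \<mu> \<pi> = 0 \<and>
      (\<exists>\<pi>star. optimal_policy m \<mu> \<pi>star \<and> J m \<mu> \<pi> < J m \<mu> \<pi>star) \<and>
      occupancy m \<mu> \<pi> $ down = 0 \<and>
      (\<forall>c. J m \<mu> (det_policy (f(init := c))) \<le> J m \<mu> \<pi>) \<and>
      (\<forall>c. J m \<mu> (det_policy (f(down := c))) \<le> J m \<mu> \<pi>) \<and>
      up' \<noteq> f init \<and> down' \<noteq> f down \<and>
      J m \<mu> \<pi> = 1 \<and>
      J m \<mu> (det_policy (f(init := up', down := down'))) = 9 \<and>
      (\<forall>\<pi>star. optimal_policy m \<mu> \<pi>star \<longrightarrow>
         \<not> occupancy_coverage m \<mu> \<mu> \<pi> \<pi>star \<and>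
         \<not> (\<exists>C. J m \<mu> \<pi>star - J m \<mu> \<pi> \<le> C * R_pol m \<mu> \<pi>)))
   \<and>
   (\<forall>(m :: ('s::finite, 'a::finite) mdp) \<mu> \<nu> \<pi> \<pi>star.
      discounted_mdp m \<and> \<mu> \<in> prob_simplex \<and> \<nu> \<in> prob_simplex \<and> \<pi> \<in> policies \<and>
      optimal_policy m \<nu> \<pi>star \<and> occupancy_coverage m \<mu> \<nu> \<pi> \<pi>star \<longrightarrow>
      (\<exists>C. J m \<nu> \<pi>star - J m \<nu> \<pi> \<le> C * R_pol m \<mu> \<pi>))"
proof (intro conjI)
  let ?f = "\<lambda>_. 1 :: 2"
  let ?\<mu> = "axis 1 1 :: real ^ 3"
  let ?\<pi> = "det_policy ?f :: real ^ 2 ^ 3"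
  let ?\<pi>2 = "det_policy (?f(1 := 2, 2 := 2)) :: real ^ 2 ^ 3"
  \<comment> \<open>All four upstream and downstream choices at once: the detour alone drops the
    return to 0, the downstream change alone leaves it at 1, and both give 9.\<close>
  have J: "J detour_mdp ?\<mu> (det_policy g) = (if g 1 = 1 then 1 else if g 2 = 2 then 9 else 0)" for g
    using exhaust_2[of "g 1"] by (auto simp: J_detour_mdp[OF det_policy_in_policies] det_policy_nth)
  have J2: "J detour_mdp ?\<mu> ?\<pi>2 = 9"
    by (simp add: J)
  have opt: "optimal_policy detour_mdp ?\<mu> ?\<pi>2"
    by (auto simp: optimal_policy_def det_policy_in_policies J2 J_detour_mdp_le)
  have no_bound: "\<not> (\<exists>C. J detour_mdp ?\<mu> \<pi>star - J detour_mdp ?\<mu> ?\<pi> \<le> C * R_pol detour_mdp ?\<mu> ?\<pi>)"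
    if "optimal_policy detour_mdp ?\<mu> \<pi>star" for \<pi>star
  proof -
    \<comment> \<open>The gap is at least 8 while the residual is 0, so no factor \<open>C\<close>
      helps.\<close>
    have "9 \<le> J detour_mdp ?\<mu> \<pi>star"
      using that J2 det_policy_in_policies unfolding optimal_policy_def by metis
    then show ?thesis
      by (simp add: R_pol_detour_mdp J)
  qed
  \<comment> \<open>Coverage would imply the bound just refuted, so the occupancy of the optimal
    policy is never computed.\<close>
  have no_coverage: "\<not> occupancy_coverage detour_mdp ?\<mu> ?\<mu> ?\<pi> \<pi>star"
    if "optimal_policy detour_mdp ?\<mu> \<pi>star" for \<pi>star
    using covered_gap_bound[OF discounted_detour_mdp axis_in_prob_simplex axis_in_prob_simplex
        det_policy_in_policies that] no_bound[OF that] by blast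
  show "\<exists>(m :: (3, 2) mdp) (\<mu> :: real ^ 3) (init :: 3) (down :: 3) (f :: 3 \<Rightarrow> 2) (up' :: 2) (down' :: 2) \<pi>.
      discounted_mdp m \<and> init \<noteq> down \<and> \<mu> = axis init 1 \<and>
      \<pi> = det_policy f \<and> \<pi> \<in> policies \<and>
      R_pol m \<mu> \<pi> = 0 \<and>
      (\<exists>\<pi>star. optimal_policy m \<mu> \<pi>star \<and> J m \<mu> \<pi> < J m \<mu> \<pi>star) \<and>
      occupancy m \<mu> \<pi> $ down = 0 \<and>
      (\<forall>c. J m \<mu> (det_policy (f(init := c))) \<le> J m \<mu> \<pi>) \<and>
      (\<forall>c. J m \<mu> (det_policy (f(down := c))) \<le> J m \<mu> \<pi>) \<and>
      up' \<noteq> f init \<and> down' \<noteq> f down \<and>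
      J m \<mu> \<pi> = 1 \<and>
      J m \<mu> (det_policy (f(init := up', down := down'))) = 9 \<and>
      (\<forall>\<pi>star. optimal_policy m \<mu> \<pi>star \<longrightarrow>
         \<not> occupancy_coverage m \<mu> \<mu> \<pi> \<pi>star \<and>
         \<not> (\<exists>C. J m \<mu> \<pi>star - J m \<mu> \<pi> \<le> C * R_pol m \<mu> \<pi>))"
    by (rule exI[of _ detour_mdp], rule exI[of _ ?\<mu>], rule exI[of _ 1], rule exI[of _ 2],
        rule exI[of _ ?f], rule exI[of _ 2], rule exI[of _ 2], rule exI[of _ ?\<pi>])
      (use opt J2 no_bound no_coverage in \<open>auto simp: discounted_detour_mdp det_policy_in_policies
        R_pol_detour_mdp occupancy_detour_mdp J intro!: exI[of _ ?\<pi>2]\<close>)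
next
  show "\<forall>(m :: ('s::finite, 'a::finite) mdp) \<mu> \<nu> \<pi> \<pi>star.
      discounted_mdp m \<and> \<mu> \<in> prob_simplex \<and> \<nu> \<in> prob_simplex \<and> \<pi> \<in> policies \<and>
      optimal_policy m \<nu> \<pi>star \<and> occupancy_coverage m \<mu> \<nu> \<pi> \<pi>star \<longrightarrow>
      (\<exists>C. J m \<nu> \<pi>star - J m \<nu> \<pi> \<le> C * R_pol m \<mu> \<pi>)"
    using covered_gap_bound by blast
qed

end
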